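(* Let $\mathcal{E}$ be a confluent terminating evolution system and let $N$ be a normalized finite object of $\mathcal{E}$. Then: (1) $N$ is homogeneous, i.e. for every finite object $A$ and every two paths $f,g\colon A\to N$ there is an automorphism $h\colon N\to N$ such that $h\circ f=g$. (2) $N$ is cofinal in the category of finite objects with paths, i.e. for every finite object $A$ there is a path from $A$ to $N$. (3) Every normalized finite object is isomorphic to $N$.
   Context: An evolution system is a structure $\mathcal{E} = \langle \mathfrak{V}, \mathcal{T}, \Theta\rangle$ where $\mathfrak{V}$ is a (locally small) category, $\Theta$ is a fixed $\mathfrak{V}$-object (the origin), and $\mathcal{T}$ is a class of $\mathfrak{V}$-arrows (transitions) such that all identities are in $\mathcal{T}$, and $h\circ t \in \mathcal{T}$ whenever $t \in \mathcal{T}$ and $h$ is an isomorphism of $\mathfrak{V}$ with $h \circ t$ defined (so all isomorphisms are transitions). Standing assumption: every evolution has a colimit in $\mathfrak{V}$. A transition is trivial if it is an isomorphism. An evolution is a functor $\vec e$ from $\omega$ (as a poset category) to $\mathfrak{V}$, with objects $E_n$, such that $E_0=\Theta$ and each arrow $E_n\to E_{n+1}$ is a transition. A path is a finite composition of transitions. An object $X$ is finite if there is a path from $\Theta$ to $X$. $\mathcal{E}$ is confluent if the category of finite objects with paths has the amalgamation property: for every two paths $f,g$ with the same finite domain there exist paths $f',g'$ with $f'\circ f=g'\circ g$. $\mathcal{E}$ is terminating if every evolution is eventually trivial, i.e. from some point on all the transitions $E_n\to E_{n+1}$ are isomorphisms. An object $X$ is normalized if every path from $X$ consists of isomorphisms,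 that is, all transitions from $X$, as well as from any object isomorphic to $X$, are trivial. *)

theory Defs
  imports Main
begin

section \<open>Categories\<close>

text \<open>
  The class of objects and the class of arrows are sets over arbitrary types. \<open>g \<cdot> f\<close> is \<open>g\<close> after
  \<open>f\<close>; it is only meaningful when \<open>f\<close> and \<open>g\<close> are arrows with \<open>Cod f = Dom g\<close>.
\<close>

record ('o, 'a) cat =
  Obj :: "'o set"
  Arr :: "'a set"
  Dom :: "'a \<Rightarrow> 'o"
  Cod :: "'a \<Rightarrow> 'o"
  Id :: "'o \<Rightarrow> 'a"
  Comp :: "'a \<Rightarrow> 'a \<Rightarrow> 'a"  (infixl "\<cdot>\<index>" 70)

definition Hom :: "('o, 'a, 'm) cat_scheme \<Rightarrow> 'o \<Rightarrow> 'o \<Rightarrow> 'a set" where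
  "Hom V X Y = {f \<in> Arr V. Dom V f = X \<and> Cod V f = Y}"

locale category =
  fixes V :: "('o, 'a, 'm) cat_scheme" (structure)
  assumes Dom_in_Obj: "f \<in> Arr V \<Longrightarrow> Dom V f \<in> Obj V"
    and Cod_in_Obj: "f \<in> Arr V \<Longrightarrow> Cod V f \<in> Obj V"
    and Id_in_Hom: "X \<in> Obj V \<Longrightarrow> Id V X \<in> Hom V X X"
    and Comp_in_Hom: "f \<in> Hom V X Y \<Longrightarrow> g \<in> Hom V Y Z \<Longrightarrow> g \<cdot> f \<in> Hom V X Z"
    and Comp_Id: "f \<in> Hom V X Y \<Longrightarrow> f \<cdot> Id V X = f"
    and Id_Comp: "f \<in> Hom V X Y \<Longrightarrow> Id V Y \<cdot> f = f"
    and Comp_assoc: "f \<in> Hom V X Y \<Longrightarrow> g \<in> Hom V Y Z \<Longrightarrow> h \<in> Hom V Z W \<Longrightarrow>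
          (h \<cdot> g) \<cdot> f = h \<cdot> (g \<cdot> f)"

definition iso :: "('o, 'a, 'm) cat_scheme \<Rightarrow> 'a \<Rightarrow> bool" where
  "iso V f \<longleftrightarrow> f \<in> Arr V \<and>
     (\<exists>g \<in> Hom V (Cod V f) (Dom V f).
        g \<cdot>\<^bsub>V\<^esub> f = Id V (Dom V f) \<and> f \<cdot>\<^bsub>V\<^esub> g = Id V (Cod V f))"

definition isomorphic :: "('o, 'a, 'm) cat_scheme \<Rightarrow> 'o \<Rightarrow> 'o \<Rightarrow> bool" where
  "isomorphic V X Y \<longleftrightarrow> (\<exists>f \<in> Hom V X Y. iso V f)"

definition automorphism :: "('o, 'a, 'm) cat_scheme \<Rightarrow> 'o \<Rightarrow> 'a \<Rightarrow> bool" where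
  "automorphism V X h \<longleftrightarrow> h \<in> Hom V X X \<and> iso V h"


section \<open>Sequences and their colimits\<close>

text \<open>
  A functor from the poset \<open>\<omega>\<close> has object part \<open>X\<close> and sends the unique arrow from \<open>m\<close> to \<open>n\<close>,
  for \<open>m \<le> n\<close>, to \<open>x m n\<close>; the values \<open>x m n\<close> with \<open>m > n\<close> are irrelevant.
\<close>

definition omega_functor ::
    "('o, 'a, 'm) cat_scheme \<Rightarrow> (nat \<Rightarrow> 'o) \<Rightarrow> (nat \<Rightarrow> nat \<Rightarrow> 'a) \<Rightarrow> bool" where
  "omega_functor V X x \<longleftrightarrow>
     (\<forall>n. X n \<in> Obj V) \<and>
     (\<forall>m n. m \<le> n \<longrightarrow> x m n \<in> Hom V (X m) (X n)) \<and>
     (\<forall>n. x n n = Id V (X n)) \<and>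
     (\<forall>k m n. k \<le> m \<longrightarrow> m \<le> n \<longrightarrow> x m n \<cdot>\<^bsub>V\<^esub> x k m = x k n)"

definition cocone ::
    "('o, 'a, 'm) cat_scheme \<Rightarrow> (nat \<Rightarrow> 'o) \<Rightarrow> (nat \<Rightarrow> nat \<Rightarrow> 'a) \<Rightarrow> 'o \<Rightarrow> (nat \<Rightarrow> 'a) \<Rightarrow> bool" where
  "cocone V X x L c \<longleftrightarrow>
     L \<in> Obj V \<and>
     (\<forall>n. c n \<in> Hom V (X n) L) \<and>
     (\<forall>m n. m \<le> n \<longrightarrow> c n \<cdot>\<^bsub>V\<^esub> x m n = c m)"

definition colimit ::
    "('o, 'a, 'm) cat_scheme \<Rightarrow> (nat \<Rightarrow> 'o) \<Rightarrow> (nat \<Rightarrow> nat \<Rightarrow> 'a) \<Rightarrow> 'o \<Rightarrow> (nat \<Rightarrow> 'a) \<Rightarrow> bool" where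
  "colimit V X x L c \<longleftrightarrow>
     cocone V X x L c \<and>
     (\<forall>M d. cocone V X x M d \<longrightarrow>
        (\<exists>!u. u \<in> Hom V L M \<and> (\<forall>n. u \<cdot>\<^bsub>V\<^esub> c n = d n)))"


section \<open>Evolution systems\<close>

record ('o, 'a) evol = "('o, 'a) cat" +
  Trans :: "'a set"
  Origin :: 'o

definition evolution ::
    "('o, 'a, 'm) evol_scheme \<Rightarrow> (nat \<Rightarrow> 'o) \<Rightarrow> (nat \<Rightarrow> nat \<Rightarrow> 'a) \<Rightarrow> bool" where
  "evolution \<E> X x \<longleftrightarrow>
     omega_functor \<E> X x \<and> X 0 = Origin \<E> \<and> (\<forall>n. x n (Suc n) \<in> Trans \<E>)"

locale evolution_system = category \<E> for \<E> :: "('o, 'a, 'm) evol_scheme" (structure) +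
  assumes Origin_in_Obj: "Origin \<E> \<in> Obj \<E>"
    and Trans_subset_Arr: "Trans \<E> \<subseteq> Arr \<E>"
    and Id_in_Trans: "X \<in> Obj \<E> \<Longrightarrow> Id \<E> X \<in> Trans \<E>"
    and iso_Comp_Trans: "t \<in> Trans \<E> \<Longrightarrow> iso \<E> h \<Longrightarrow> Dom \<E> h = Cod \<E> t \<Longrightarrow> h \<cdot> t \<in> Trans \<E>"
    and evolution_has_colimit: "evolution \<E> E e \<Longrightarrow> \<exists>L c. colimit \<E> E e L c"

text \<open>
  \<open>transition_seq \<E> X ts Y\<close>: the list \<open>ts\<close> is a composable sequence of transitions leading from
  \<open>X\<close> to \<open>Y\<close>, in the order in which they are traversed. Allowing the empty list adds no paths,
  because its composite is an identity, which is a transition.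
\<close>

primrec transition_seq :: "('o, 'a, 'm) evol_scheme \<Rightarrow> 'o \<Rightarrow> 'a list \<Rightarrow> 'o \<Rightarrow> bool" where
  "transition_seq \<E> X [] Y \<longleftrightarrow> X \<in> Obj \<E> \<and> X = Y"
| "transition_seq \<E> X (t # ts) Y \<longleftrightarrow>
     t \<in> Trans \<E> \<and> Dom \<E> t = X \<and> transition_seq \<E> (Cod \<E> t) ts Y"

primrec composite :: "('o, 'a, 'm) evol_scheme \<Rightarrow> 'o \<Rightarrow> 'a list \<Rightarrow> 'a" where
  "composite \<E> X [] = Id \<E> X"
| "composite \<E> X (t # ts) = composite \<E> (Cod \<E> t) ts \<cdot>\<^bsub>\<E>\<^esub> t"

definition path :: "('o, 'a, 'm) evol_scheme \<Rightarrow> 'o \<Rightarrow> 'o \<Rightarrow> 'a \<Rightarrow> bool" where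
  "path \<E> X Y f \<longleftrightarrow> (\<exists>ts. transition_seq \<E> X ts Y \<and> f = composite \<E> X ts)"

definition finite_object :: "('o, 'a, 'm) evol_scheme \<Rightarrow> 'o \<Rightarrow> bool" where
  "finite_object \<E> X \<longleftrightarrow> (\<exists>f. path \<E> (Origin \<E>) X f)"

definition confluent :: "('o, 'a, 'm) evol_scheme \<Rightarrow> bool" where
  "confluent \<E> \<longleftrightarrow>
     (\<forall>C A B f g. finite_object \<E> C \<longrightarrow> path \<E> C A f \<longrightarrow> path \<E> C B g \<longrightarrow>
        (\<exists>D f' g'. path \<E> A D f' \<and> path \<E> B D g' \<and> f' \<cdot>\<^bsub>\<E>\<^esub> f = g' \<cdot>\<^bsub>\<E>\<^esub> g))"

definition terminating :: "('o, 'a, 'm) evol_scheme \<Rightarrow> bool" where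
  "terminating \<E> \<longleftrightarrow>
     (\<forall>X x. evolution \<E> X x \<longrightarrow> (\<exists>m. \<forall>n \<ge> m. iso \<E> (x n (Suc n))))"

definition normalized :: "('o, 'a, 'm) evol_scheme \<Rightarrow> 'o \<Rightarrow> bool" where
  "normalized \<E> X \<longleftrightarrow>
     X \<in> Obj \<E> \<and> (\<forall>ts Y. transition_seq \<E> X ts Y \<longrightarrow> (\<forall>t \<in> set ts. iso \<E> t))"

definition homogeneous_object :: "('o, 'a, 'm) evol_scheme \<Rightarrow> 'o \<Rightarrow> bool" where
  "homogeneous_object \<E> N \<longleftrightarrow>
     (\<forall>A f g. finite_object \<E> A \<longrightarrow> path \<E> A N f \<longrightarrow> path \<E> A N g \<longrightarrow>
        (\<exists>h. automorphism \<E> N h \<and> h \<cdot>\<^bsub>\<E>\<^esub> f = g))"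

definition cofinal_object :: "('o, 'a, 'm) evol_scheme \<Rightarrow> 'o \<Rightarrow> bool" where
  "cofinal_object \<E> N \<longleftrightarrow> (\<forall>A. finite_object \<E> A \<longrightarrow> (\<exists>f. path \<E> A N f))"


subsection \<open>Normalized objects in terms of single transitions\<close>

context evolution_system
begin

lemma iso_in_Trans:
  assumes "iso \<E> h"
  shows "h \<in> Trans \<E>"
proof -
  from assms have "h \<in> Arr \<E>" by (simp add: iso_def)
  then have o: "Dom \<E> h \<in> Obj \<E>" and hom: "h \<in> Hom \<E> (Dom \<E> h) (Cod \<E> h)"
    by (auto simp: Hom_def Dom_in_Obj)
  from Id_in_Hom[OF o] have "Dom \<E> h = Cod \<E> (Id \<E> (Dom \<E> h))" by (simp add: Hom_def)
  from iso_Comp_Trans[OF Id_in_Trans[OF o] assms this] Comp_Id[OF hom]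
  show ?thesis by simp
qed

lemma iso_Comp:
  assumes "iso \<E> f" "iso \<E> g" "Dom \<E> g = Cod \<E> f"
  shows "iso \<E> (g \<cdot> f) \<and> g \<cdot> f \<in> Hom \<E> (Dom \<E> f) (Cod \<E> g)"
proof -
  let ?X = "Dom \<E> f" and ?Y = "Cod \<E> f" and ?Z = "Cod \<E> g"
  have f: "f \<in> Hom \<E> ?X ?Y" and g: "g \<in> Hom \<E> ?Y ?Z"
    using assms by (auto simp: iso_def Hom_def)
  obtain f' where f': "f' \<in> Hom \<E> ?Y ?X" "f' \<cdot> f = Id \<E> ?X" "f \<cdot> f' = Id \<E> ?Y"
    using assms(1) by (auto simp: iso_def)
  obtain g' where g': "g' \<in> Hom \<E> ?Z ?Y" "g' \<cdot> g = Id \<E> ?Y" "g \<cdot> g' = Id \<E> ?Z"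
    using assms(2,3) by (auto simp: iso_def)
  have gf: "g \<cdot> f \<in> Hom \<E> ?X ?Z" using f g by (rule Comp_in_Hom)
  have fg': "f' \<cdot> g' \<in> Hom \<E> ?Z ?X" using g'(1) f'(1) by (rule Comp_in_Hom)
  have "(f' \<cdot> g') \<cdot> (g \<cdot> f) = f' \<cdot> (g' \<cdot> (g \<cdot> f))" by (rule Comp_assoc[OF gf g'(1) f'(1)])
  also have "g' \<cdot> (g \<cdot> f) = f" using Comp_assoc[OF f g g'(1)] g'(2) Id_Comp[OF f] by simp
  finally have 1: "(f' \<cdot> g') \<cdot> (g \<cdot> f) = Id \<E> ?X" using f'(2) by simp
  have "(g \<cdot> f) \<cdot> (f' \<cdot> g') = g \<cdot> (f \<cdot> (f' \<cdot> g'))" by (rule Comp_assoc[OF fg' f g])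
  also have "f \<cdot> (f' \<cdot> g') = g'" using Comp_assoc[OF g'(1) f'(1) f] f'(3) Id_Comp[OF g'(1)] by simp
  finally have 2: "(g \<cdot> f) \<cdot> (f' \<cdot> g') = Id \<E> ?Z" using g'(3) by simp
  show ?thesis using gf fg' 1 2 unfolding iso_def Hom_def by auto
qed

lemma normalized_iff:
  "normalized \<E> X \<longleftrightarrow>
     X \<in> Obj \<E> \<and>
     (\<forall>Y. isomorphic \<E> X Y \<longrightarrow> (\<forall>t \<in> Trans \<E>. Dom \<E> t = Y \<longrightarrow> iso \<E> t))"
  (is "?L \<longleftrightarrow> ?R")
proof
  assume L: ?L
  show ?R
  proof (intro conjI allI impI ballI)
    show "X \<in> Obj \<E>" using L by (simp add: normalized_def)
  next
    fix Y t assume "isomorphic \<E> X Y" and t: "t \<in> Trans \<E>" "Dom \<E> t = Y"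
    then obtain h where h: "h \<in> Hom \<E> X Y" "iso \<E> h" by (auto simp: isomorphic_def)
    have "Cod \<E> t \<in> Obj \<E>" using t(1) Trans_subset_Arr Cod_in_Obj by blast
    then have "transition_seq \<E> X [h, t] (Cod \<E> t)"
      using h t iso_in_Trans[OF h(2)] by (simp add: Hom_def)
    then show "iso \<E> t" using L unfolding normalized_def by (meson list.set_intros)
  qed
next
  assume R: ?R
  have X: "X \<in> Obj \<E>" using R by blast
  have "\<forall>t \<in> set ts. iso \<E> t" if "transition_seq \<E> Y ts Z" "isomorphic \<E> X Y" for Y ts Z
    using that
  proof (induction ts arbitrary: Y)
    case (Cons t ts)
    then have t: "t \<in> Trans \<E>" "Dom \<E> t = Y" and s: "transition_seq \<E> (Cod \<E> t) ts Z" by auto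
    with R Cons.prems(2) have it: "iso \<E> t" by blast
    obtain h where h: "h \<in> Hom \<E> X Y" "iso \<E> h" using Cons.prems(2) by (auto simp: isomorphic_def)
    have "Dom \<E> h = X" "Cod \<E> h = Y" using h(1) by (auto simp: Hom_def)
    with iso_Comp[OF h(2) it] t(2) have "isomorphic \<E> X (Cod \<E> t)"
      by (auto simp: isomorphic_def)
    with Cons.IH[OF s] it show ?case by simp
  qed simp
  moreover have "isomorphic \<E> X X"
    using Id_in_Hom[OF X] Comp_Id[OF Id_in_Hom[OF X]]
    unfolding isomorphic_def iso_def by (auto simp: Hom_def)
  ultimately show ?L using X unfolding normalized_def by blast
qed

end

end

(* Every path starting at a normalized object is an isomorphism, and the inverse of an isomorphism
   is again a path. Amalgamating two paths A -> N therefore yields two isomorphisms out of N, which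
   combine to an automorphism; amalgamating the paths from the origin to A and to N yields a path
   A -> D together with an isomorphism N -> D, hence a path A -> N. If A is normalized as well, this
   path is an isomorphism. *)
theory Submission
  imports Defs
begin

context evolution_system
begin

lemma Trans_in_Hom: "t \<in> Trans \<E> \<Longrightarrow> t \<in> Hom \<E> (Dom \<E> t) (Cod \<E> t)"
  using Trans_subset_Arr by (auto simp: Hom_def)

lemma composite_in_Hom: "transition_seq \<E> X ts Y \<Longrightarrow> composite \<E> X ts \<in> Hom \<E> X Y"
proof (induction ts arbitrary: X)
  case (Cons t ts)
  then show ?case using Comp_in_Hom[OF Trans_in_Hom[of t]] by auto
qed (auto intro: Id_in_Hom)

lemma transition_seq_append:
  "transition_seq \<E> X ts Y \<Longrightarrow> transition_seq \<E> Y us Z \<Longrightarrow> transition_seq \<E> X (ts @ us) Z"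
  by (induction ts arbitrary: X) auto

text \<open>Associativity moves the head of the first list past the rest. With
  \<open>transition_seq_append\<close> this makes paths closed under composition.\<close>

lemma composite_append:
  assumes "transition_seq \<E> X ts Y" "transition_seq \<E> Y us Z"
  shows "composite \<E> X (ts @ us) = composite \<E> Y us \<cdot> composite \<E> X ts"
  using assms
proof (induction ts arbitrary: X)
  case Nil
  then show ?case using Comp_Id[OF composite_in_Hom] by auto
next
  case (Cons t ts)
  then have t: "t \<in> Hom \<E> X (Cod \<E> t)" and ts: "transition_seq \<E> (Cod \<E> t) ts Y"
    using Trans_in_Hom[of t] by auto
  show ?case
    using Cons.IH[OF ts Cons.prems(2)]
      Comp_assoc[OF t composite_in_Hom[OF ts] composite_in_Hom[OF Cons.prems(2)]]
    by simp
qed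

lemma path_in_Hom: "path \<E> X Y f \<Longrightarrow> f \<in> Hom \<E> X Y"
  unfolding path_def using composite_in_Hom by blast

lemma path_Comp: "path \<E> X Y f \<Longrightarrow> path \<E> Y Z g \<Longrightarrow> path \<E> X Z (g \<cdot> f)"
  unfolding path_def using transition_seq_append composite_append by metis

text \<open>Isomorphisms are transitions by \<open>iso_in_Trans\<close>, so a one-element sequence
  suffices; its composite carries a trailing identity, which \<open>Id_Comp\<close> removes.\<close>

lemma iso_path:
  assumes "iso \<E> f" "f \<in> Hom \<E> X Y"
  shows "path \<E> X Y f"
proof -
  have "Y \<in> Obj \<E>" "Dom \<E> f = X" "Cod \<E> f = Y"
    using assms(2) Cod_in_Obj by (auto simp: Hom_def)
  then have "transition_seq \<E> X [f] Y" "f = composite \<E> X [f]"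
    using iso_in_Trans[OF assms(1)] Id_Comp[OF assms(2)] by auto
  then show ?thesis unfolding path_def by blast
qed

text \<open>The two equations defining an isomorphism are symmetric in the arrow and its inverse, so
  the inverse is an isomorphism too.\<close>

lemma iso_inverse:
  assumes "iso \<E> f" "f \<in> Hom \<E> X Y"
  obtains g where "g \<in> Hom \<E> Y X" "iso \<E> g" "g \<cdot> f = Id \<E> X"
  using assms unfolding iso_def Hom_def by auto

lemma iso_Id: "X \<in> Obj \<E> \<Longrightarrow> iso \<E> (Id \<E> X)"
  using Id_in_Hom[of X] Comp_Id[OF Id_in_Hom, of X] by (auto simp: iso_def Hom_def)

lemma composite_iso:
  "transition_seq \<E> X ts Y \<Longrightarrow> \<forall>t \<in> set ts. iso \<E> t \<Longrightarrow> iso \<E> (composite \<E> X ts)"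
proof (induction ts arbitrary: X)
  case (Cons t ts)
  then have "composite \<E> (Cod \<E> t) ts \<in> Hom \<E> (Cod \<E> t) Y"
    by (auto intro: composite_in_Hom)
  with Cons show ?case using iso_Comp[of t "composite \<E> (Cod \<E> t) ts"] by (auto simp: Hom_def)
qed (auto intro: iso_Id)

text \<open>\<open>normalized\<close> constrains the single transitions of a sequence; closure of
  isomorphisms under composition carries this over to the composite.\<close>

lemma normalized_path_iso: "normalized \<E> X \<Longrightarrow> path \<E> X Y f \<Longrightarrow> iso \<E> f"
  unfolding normalized_def path_def using composite_iso by blast

lemma normalized_homogeneous:
  assumes "confluent \<E>" "normalized \<E> N"
  shows "homogeneous_object \<E> N"
  unfolding homogeneous_object_def
proof (intro allI impI)
  fix A f g
  assume A: "finite_object \<E> A" and f: "path \<E> A N f" and g: "path \<E> A N g"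
  obtain D f' g' where f': "path \<E> N D f'" and g': "path \<E> N D g'" and eq: "f' \<cdot> f = g' \<cdot> g"
    using assms(1) A f g unfolding confluent_def by blast
  have isos: "iso \<E> f'" "iso \<E> g'"
    using normalized_path_iso[OF assms(2)] f' g' by blast+
  \<comment> \<open>Inverting \<open>g'\<close> leads back from the amalgam \<open>D\<close> to
    \<open>N\<close>; the automorphism sought is \<open>k \<cdot> f'\<close>.\<close>
  obtain k where k: "k \<in> Hom \<E> D N" "iso \<E> k" "k \<cdot> g' = Id \<E> N"
    using iso_inverse[OF isos(2) path_in_Hom[OF g']] .
  have "(k \<cdot> f') \<cdot> f = k \<cdot> (g' \<cdot> g)"
    using Comp_assoc[OF path_in_Hom[OF f] path_in_Hom[OF f'] k(1)] eq by simp
  also have "\<dots> = g"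
    using Comp_assoc[OF path_in_Hom[OF g] path_in_Hom[OF g'] k(1)] k(3)
      Id_Comp[OF path_in_Hom[OF g]] by simp
  finally have "(k \<cdot> f') \<cdot> f = g" .
  moreover have "automorphism \<E> N (k \<cdot> f')"
    using iso_Comp[OF isos(1) k(2)] k(1) path_in_Hom[OF f']
    by (auto simp: automorphism_def Hom_def)
  ultimately show "\<exists>h. automorphism \<E> N h \<and> h \<cdot> f = g" by blast
qed

lemma normalized_cofinal:
  assumes "confluent \<E>" "finite_object \<E> N" "normalized \<E> N"
  shows "cofinal_object \<E> N"
  unfolding cofinal_object_def
proof (intro allI impI)
  fix A assume "finite_object \<E> A"
  then obtain a where a: "path \<E> (Origin \<E>) A a" unfolding finite_object_def by blast
  obtain n where n: "path \<E> (Origin \<E>) N n" using assms(2) unfolding finite_object_def by blast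
  \<comment> \<open>Confluence only amalgamates over finite domains; the identity is a path showing
    that the origin is one.\<close>
  have "finite_object \<E> (Origin \<E>)"
    using iso_path[OF iso_Id Id_in_Hom] Origin_in_Obj unfolding finite_object_def by blast
  then obtain D f g where f: "path \<E> A D f" and g: "path \<E> N D g"
    using assms(1) a n unfolding confluent_def by blast
  \<comment> \<open>The inverse of \<open>g\<close> is a path from \<open>D\<close> back to
    \<open>N\<close>, which prolongs \<open>f\<close>.\<close>
  obtain k where "k \<in> Hom \<E> D N" "iso \<E> k"
    using iso_inverse[OF normalized_path_iso[OF assms(3) g] path_in_Hom[OF g]] .
  then show "\<exists>f. path \<E> A N f" using path_Comp[OF f] iso_path by blast
qed

end

theorem theorem5p14:
  fixes \<E> :: "('o, 'a, 'm) evol_scheme"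
    and N :: 'o
  assumes "evolution_system \<E>"
    and "confluent \<E>"
    and "terminating \<E>"
    and "finite_object \<E> N"
    and "normalized \<E> N"
  shows "homogeneous_object \<E> N \<and>
    cofinal_object \<E> N \<and>
    (\<forall>M. finite_object \<E> M \<longrightarrow> normalized \<E> M \<longrightarrow> isomorphic \<E> M N)"
proof -
  interpret evolution_system \<E> by fact
  have cofinal: "cofinal_object \<E> N" using normalized_cofinal assms by blast
  have "isomorphic \<E> M N" if M: "finite_object \<E> M" "normalized \<E> M" for M
  proof -
    \<comment> \<open>The path ends in \<open>N\<close> but starts at \<open>M\<close>, so it is
      normality of \<open>M\<close> that makes it an isomorphism.\<close>
    obtain f where "path \<E> M N f" using cofinal M(1) unfolding cofinal_object_def by blast
    then show ?thesis
      using normalized_path_iso[OF M(2)] path_in_Hom unfolding isomorphic_def by blast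
  qed
  with cofinal normalized_homogeneous[OF assms(2,5)] show ?thesis by blast
qed

end
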